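(* Let $q\geqslant 5$ be a prime power and $G=\mathrm{PSL}_2(q)$. If $\mathrm{Cay}(G,S)$ is a cubic graphical regular representation of $G$, then $S$ is a set of three involutions.
   Context: An involution is a group element of order $2$. For a group $G$ and a subset $S\subset G$ with $1\notin S$ and $S=S^{-1}:=\{g^{-1}\mid g\in S\}$, the Cayley graph $\mathrm{Cay}(G,S)$ is the graph with vertex set $G$ in which two vertices $x,y$ are adjacent if and only if $yx^{-1}\in S$. Identifying $G$ with its right regular representation (each $g\in G$ acting by $x\mapsto xg$), $G$ is a subgroup of the graph automorphism group $\mathrm{Aut}(\mathrm{Cay}(G,S))$. The graph $\mathrm{Cay}(G,S)$ is called a graphical regular representation (GRR) of $G$ if $\mathrm{Aut}(\mathrm{Cay}(G,S))=G$. It is a cubic GRR if moreover the graph is cubic, i.e. $|S|=3$. The group $\mathrm{PSL}_2(q)$ is the projective special linear group of dimension two over the field with $q$ elements. *)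

theory Defs
  imports
    "HOL-Analysis.Determinants"
    "HOL-Algebra.Algebra"
    "HOL-Number_Theory.Prime_Powers"
    "Graph_Theory.Pair_Digraph"
begin

section \<open>Projective special linear groups\<close>

definition group_center :: "('a, 'b) monoid_scheme \<Rightarrow> 'a set" where
  "group_center G = {z \<in> carrier G. \<forall>g \<in> carrier G. z \<otimes>\<^bsub>G\<^esub> g = g \<otimes>\<^bsub>G\<^esub> z}"

lemma (in group) normal_group_center: "group_center G \<lhd> G"
proof (rule normal_invI)
  show "subgroup (group_center G) G"
  proof (rule subgroupI)
    fix a assume "a \<in> group_center G"
    then have a: "a \<in> carrier G" and comm: "\<And>g. g \<in> carrier G \<Longrightarrow> a \<otimes> g = g \<otimes> a"
      by (simp_all add: group_center_def)
    have "inv a \<otimes> g = g \<otimes> inv a" if g: "g \<in> carrier G" for g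
    proof -
      have "inv a \<otimes> g = inv a \<otimes> (g \<otimes> a) \<otimes> inv a"
        using a g by (simp add: m_assoc)
      also have "\<dots> = inv a \<otimes> (a \<otimes> g) \<otimes> inv a"
        using comm[OF g] by simp
      also have "\<dots> = g \<otimes> inv a"
        using a g by (simp add: m_assoc[symmetric])
      finally show ?thesis .
    qed
    then show "inv a \<in> group_center G"
      using a by (simp add: group_center_def)
  next
    fix a b assume "a \<in> group_center G" "b \<in> group_center G"
    then have a: "a \<in> carrier G" "\<And>g. g \<in> carrier G \<Longrightarrow> a \<otimes> g = g \<otimes> a"
      and b: "b \<in> carrier G" "\<And>g. g \<in> carrier G \<Longrightarrow> b \<otimes> g = g \<otimes> b"
      by (simp_all add: group_center_def)
    have "a \<otimes> b \<otimes> g = g \<otimes> (a \<otimes> b)" if g: "g \<in> carrier G" for g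
    proof -
      have "a \<otimes> b \<otimes> g = a \<otimes> (g \<otimes> b)"
        using a(1) b(1) b(2)[OF g] g by (simp add: m_assoc)
      also have "\<dots> = (a \<otimes> g) \<otimes> b"
        using a(1) b(1) g by (simp add: m_assoc)
      also have "\<dots> = g \<otimes> (a \<otimes> b)"
        using a(1) b(1) a(2)[OF g] g by (simp add: m_assoc)
      finally show ?thesis .
    qed
    then show "a \<otimes> b \<in> group_center G"
      using a(1) b(1) by (simp add: group_center_def)
  qed (auto simp: group_center_def)
next
  fix x h assume x: "x \<in> carrier G" and h: "h \<in> group_center G"
  then have "h \<in> carrier G" "x \<otimes> h = h \<otimes> x"
    by (simp_all add: group_center_def)
  then have "x \<otimes> h \<otimes> inv x = h"
    using x by (simp add: m_assoc)
  with h show "x \<otimes> h \<otimes> inv x \<in> group_center G" by simp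
qed

definition SL :: "('a::field^'n^'n) monoid" where
  "SL = \<lparr>carrier = {A. det A = 1}, mult = (**), one = mat 1\<rparr>"

lemma group_SL: "group (SL :: ('a::field^'n^'n) monoid)"
proof (rule groupI)
  fix A :: "'a^'n^'n" assume "A \<in> carrier SL"
  then have A: "det A = 1" by (simp add: SL_def)
  then obtain B where B: "B ** A = mat 1"
    by (metis invertible_det_nz invertible_def zero_neq_one)
  then have "det B = 1"
    using A by (metis det_I det_mul mult.right_neutral)
  with B show "\<exists>B \<in> carrier SL. B \<otimes>\<^bsub>SL\<^esub> A = \<one>\<^bsub>SL\<^esub>"
    by (auto simp: SL_def)
qed (auto simp: SL_def det_mul matrix_mul_assoc)

definition PSL :: "('a::field^'n^'n) set monoid" where
  "PSL = SL Mod group_center SL"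

lemma group_PSL: "group (PSL :: ('a::field^'n^'n) set monoid)"
  unfolding PSL_def
  by (intro normal.factorgroup_is_group group.normal_group_center group_SL)


section \<open>Cayley graphs\<close>

definition involution :: "('a, 'b) monoid_scheme \<Rightarrow> 'a \<Rightarrow> bool" where
  "involution G x \<longleftrightarrow> x \<in> carrier G \<and> group.ord G x = 2"

definition connection_set :: "('a, 'b) monoid_scheme \<Rightarrow> 'a set \<Rightarrow> bool" where
  "connection_set G S \<longleftrightarrow>
     S \<subseteq> carrier G \<and> \<one>\<^bsub>G\<^esub> \<notin> S \<and> S = (\<lambda>g. inv\<^bsub>G\<^esub> g) ` S"

text \<open>An undirected graph is represented by its symmetric set of arcs.\<close>

definition Cay :: "('a, 'b) monoid_scheme \<Rightarrow> 'a set \<Rightarrow> 'a pair_pre_digraph" where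
  "Cay G S =
     \<lparr>pverts = carrier G,
      parcs = {(x, y). x \<in> carrier G \<and> y \<in> carrier G \<and> y \<otimes>\<^bsub>G\<^esub> inv\<^bsub>G\<^esub> x \<in> S}\<rparr>"

lemma (in group) pair_graph_Cay:
  assumes "finite (carrier G)" and S: "connection_set G S"
  shows "pair_graph (Cay G S)"
proof
  show "finite (parcs (Cay G S))"
    by (rule finite_subset[of _ "carrier G \<times> carrier G"]) (auto simp: Cay_def assms)
  have "x \<otimes> inv y \<in> S"
    if "x \<in> carrier G" "y \<in> carrier G" "y \<otimes> inv x \<in> S" for x y
  proof -
    have "inv (y \<otimes> inv x) \<in> S"
      using S that(3) unfolding connection_set_def by blast
    then show ?thesis using that by (simp add: inv_mult_group)
  qed
  then show "symmetric (Cay G S)"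
    by (auto simp: symmetric_def Cay_def intro!: symI)
qed (use assms in \<open>auto simp: Cay_def connection_set_def\<close>)

text \<open>Automorphisms are taken in \<^term>\<open>Bij V\<close>, i.e. extended by \<^term>\<open>undefined\<close>
  outside the vertex set, so that each permutation of the vertices is counted once.\<close>

definition graph_Aut :: "'a pair_pre_digraph \<Rightarrow> ('a \<Rightarrow> 'a) set" where
  "graph_Aut \<Gamma> =
     {f \<in> Bij (pverts \<Gamma>).
        \<forall>x \<in> pverts \<Gamma>. \<forall>y \<in> pverts \<Gamma>. (f x, f y) \<in> parcs \<Gamma> \<longleftrightarrow> (x, y) \<in> parcs \<Gamma>}"

definition right_regular :: "('a, 'b) monoid_scheme \<Rightarrow> ('a \<Rightarrow> 'a) set" where
  "right_regular G = (\<lambda>g. \<lambda>x \<in> carrier G. x \<otimes>\<^bsub>G\<^esub> g) ` carrier G"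

lemma (in group) right_regular_subset_graph_Aut_Cay:
  "right_regular G \<subseteq> graph_Aut (Cay G S)"
proof
  fix f assume "f \<in> right_regular G"
  then obtain g where g: "g \<in> carrier G" and f: "f = (\<lambda>x \<in> carrier G. x \<otimes> g)"
    by (auto simp: right_regular_def)
  have "bij_betw f (carrier G) (carrier G)"
    by (rule bij_betw_byWitness[where f' = "\<lambda>x. x \<otimes> inv g"]) (use g in \<open>auto simp: f m_assoc\<close>)
  moreover have "(y \<otimes> g) \<otimes> inv (x \<otimes> g) = y \<otimes> inv x"
    if "x \<in> carrier G" "y \<in> carrier G" for x y
  proof -
    have "g \<otimes> (inv g \<otimes> inv x) = inv x"
      using g that by (simp add: m_assoc[symmetric])
    then show ?thesis
      using g that by (simp add: inv_mult_group m_assoc)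
  qed
  ultimately show "f \<in> graph_Aut (Cay G S)"
    using g by (auto simp: graph_Aut_def Cay_def Bij_def f)
qed

definition GRR :: "('a, 'b) monoid_scheme \<Rightarrow> 'a set \<Rightarrow> bool" where
  "GRR G S \<longleftrightarrow> connection_set G S \<and> graph_Aut (Cay G S) = right_regular G"

definition cubic_GRR :: "('a, 'b) monoid_scheme \<Rightarrow> 'a set \<Rightarrow> bool" where
  "cubic_GRR G S \<longleftrightarrow> GRR G S \<and> card S = 3"

end

theory Submission
  imports Defs
begin

text \<open>A three-element inverse-closed set of elements other than \<open>1\<close> that is not made of
  involutions has the form \<open>{x, x\<^sup>-\<^sup>1, y}\<close> with \<open>x \<noteq> x\<^sup>-\<^sup>1\<close> and \<open>y = y\<^sup>-\<^sup>1\<close>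
  (\<open>GRR_card_3_non_involution\<close>).  Such a set is excluded by two ways of producing a nontrivial
  graph automorphism that fixes the vertex \<open>1\<close>, which a graphical regular representation
  does not have: a group automorphism preserving \<open>S\<close> (\<open>GRR_automorphism_trivial\<close>), or a shift
  of a single connected component when \<open>S\<close> lies in a proper subgroup (\<open>GRR_generates\<close>).

  That one of the two always occurs in the projective special linear group of dimension two comes
  from the commutator \<open>C = AB - BA\<close> of matrices \<open>A, B\<close> representing \<open>x, y\<close>.  It satisfies
  \<open>ACA = C\<close> and \<open>BCB = C\<close> (\<open>commutator_sandwich\<close>).  If \<open>C\<close> is invertible, these equations say
  that conjugation by \<open>C\<close> inverts both \<open>A\<close> and \<open>B\<close>
  (\<open>SL2_simultaneous_inversion\<close>); modulo the center it swaps \<open>x\<close> with \<open>x\<^sup>-\<^sup>1\<close> and fixes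
  \<open>y\<close>, so it preserves \<open>S\<close> without being trivial.  If \<open>C\<close> is singular, then \<open>A\<close> and
  \<open>B\<close> lie in a common proper subgroup (\<open>SL2_singular_commutator_subgroup\<close>): the centralizer of
  \<open>A\<close> when \<open>C = 0\<close>, and the stabilizer of the line \<open>ker C\<close> otherwise.\<close>

section \<open>Rigidity of graphical regular representations\<close>

context group
begin

text \<open>The right regular action is free, so vertex stabilizers are trivial.\<close>

lemma GRR_fixing_one:
  assumes "GRR G S" "f \<in> graph_Aut (Cay G S)" "f \<one> = \<one>" "x \<in> carrier G"
  shows "f x = x"
proof -
  obtain g where g: "g \<in> carrier G" and f: "f = (\<lambda>x \<in> carrier G. x \<otimes> g)"
    using assms(1,2) by (auto simp: GRR_def right_regular_def)
  then have "g = \<one>" using assms(3) by simp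
  then show ?thesis using assms(4) by (simp add: f)
qed

lemma GRR_automorphism_trivial:
  assumes S: "GRR G S" and f: "f \<in> iso G G" and fS: "f ` S = S" and x: "x \<in> carrier G"
  shows "f x = x"
proof -
  interpret f: group_hom G G f
    using f by unfold_locales (simp add: iso_def)
  have bij: "bij_betw f (carrier G) (carrier G)"
    using f by (simp add: iso_def)
  have SG: "S \<subseteq> carrier G"
    using S by (simp add: GRR_def connection_set_def)
  have mem: "f g \<in> S \<longleftrightarrow> g \<in> S" if "g \<in> carrier G" for g
    using inj_on_image_mem_iff[OF bij_betw_imp_inj_on[OF bij] that SG] fS by simp
  have "(restrict f (carrier G)) \<in> graph_Aut (Cay G S)"
    using bij mem by (auto simp: graph_Aut_def Cay_def Bij_def simp flip: f.hom_inv f.hom_mult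
        cong: bij_betw_cong)
  from GRR_fixing_one[OF S this _ x] show ?thesis using x by simp
qed

text \<open>The component of a vertex of the Cayley graph lies inside a right coset of any subgroup
  containing \<open>S\<close>.  Hence one coset \<open>Hg\<close> other than \<open>H\<close> can be moved by an automorphism on its
  own; right multiplication by an element of \<open>g\<^sup>-\<^sup>1Hg\<close> maps that coset to itself.\<close>

lemma GRR_generates:
  assumes S: "GRR G S" "S \<noteq> {}" and H: "subgroup H G" "S \<subseteq> H"
  shows "H = carrier G"
proof (rule ccontr)
  interpret H: subgroup H G by (rule H)
  assume "H \<noteq> carrier G"
  then obtain g where g: "g \<in> carrier G" "g \<notin> H"
    using H.subset by blast
  obtain h where h: "h \<in> H" "h \<in> carrier G" "h \<noteq> \<one>"
    using S H by (auto simp: GRR_def connection_set_def)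
  \<comment> \<open>A nontrivial element whose right multiplication preserves the coset \<open>Hg\<close>.\<close>
  define k where "k = inv g \<otimes> h \<otimes> g"
  have k: "k \<in> carrier G" using g h by (simp add: k_def)
  define f where "f = (\<lambda>x \<in> carrier G. if x \<otimes> inv g \<in> H then x \<otimes> k else x)"
  have step: "x \<otimes> k \<otimes> inv g = (x \<otimes> inv g) \<otimes> h" if "x \<in> carrier G" for x
    using that g h by (simp add: k_def m_assoc)
  have step': "x \<otimes> inv k \<otimes> inv g = (x \<otimes> inv g) \<otimes> inv h" if "x \<in> carrier G" for x
    using that g h by (simp add: k_def m_assoc inv_mult_group)
  have memk: "x \<otimes> k \<otimes> inv g \<in> H" "x \<otimes> inv k \<otimes> inv g \<in> H"
    if "x \<in> carrier G" "x \<otimes> inv g \<in> H" for x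
    using that h by (simp_all add: step step')
  have bij: "bij_betw f (carrier G) (carrier G)"
    by (rule bij_betw_byWitness[where f' = "\<lambda>x. if x \<otimes> inv g \<in> H then x \<otimes> inv k else x"])
      (use k memk in \<open>auto simp: f_def m_assoc\<close>)
  have cancel: "inv a \<otimes> (a \<otimes> b) = b" if "a \<in> carrier G" "b \<in> carrier G" for a b
    using that by (simp add: m_assoc[symmetric])
  have cancel': "a \<otimes> (inv a \<otimes> b) = b" if "a \<in> carrier G" "b \<in> carrier G" for a b
    using that by (simp add: m_assoc[symmetric])
  \<comment> \<open>In particular adjacent vertices lie on the same side of the partition into \<open>Hg\<close> and
    its complement, because \<open>S \<subseteq> H\<close>.\<close>
  have same: "x \<otimes> inv g \<in> H \<longleftrightarrow> y \<otimes> inv g \<in> H"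
    if "x \<in> carrier G" "y \<in> carrier G" "y \<otimes> inv x \<in> H" for x y
  proof -
    have "y \<otimes> inv g = (y \<otimes> inv x) \<otimes> (x \<otimes> inv g)"
         "x \<otimes> inv g = inv (y \<otimes> inv x) \<otimes> (y \<otimes> inv g)"
      using that g by (simp_all add: m_assoc inv_mult_group cancel)
    then show ?thesis using that(3) H.m_closed H.m_inv_closed by metis
  qed
  have arc: "f y \<otimes> inv (f x) \<in> S \<longleftrightarrow> y \<otimes> inv x \<in> S"
    if x: "x \<in> carrier G" and y: "y \<in> carrier G" for x y
  proof (cases "x \<otimes> inv g \<in> H \<longleftrightarrow> y \<otimes> inv g \<in> H")
    case True
    have "(y \<otimes> k) \<otimes> inv (x \<otimes> k) = y \<otimes> inv x"
      using x y k by (simp add: m_assoc inv_mult_group cancel')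
    then show ?thesis using True x y by (auto simp: f_def)
  next
    case False
    have fm: "f z \<in> carrier G" "f z \<otimes> inv g \<in> H \<longleftrightarrow> z \<otimes> inv g \<in> H" if "z \<in> carrier G" for z
      using that k memk by (auto simp: f_def)
    have "y \<otimes> inv x \<notin> H" "f y \<otimes> inv (f x) \<notin> H"
      using False same[OF x y] same[OF fm(1)[OF x] fm(1)[OF y]] fm(2)[OF x] fm(2)[OF y] by blast+
    then show ?thesis using H(2) by blast
  qed
  have "f \<in> graph_Aut (Cay G S)"
    using bij arc bij_betwE[OF bij] by (auto simp: graph_Aut_def Cay_def Bij_def f_def)
  moreover have "f \<one> = \<one>"
    using g H.m_inv_closed[of "inv g"] by (auto simp: f_def)
  ultimately have "f g = g" using GRR_fixing_one S(1) g(1) by blast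
  then have "h \<otimes> g = g"
    using g h by (simp add: f_def k_def m_assoc[symmetric])
  then show False using g h by simp
qed

lemma GRR_card_3_non_involution:
  assumes S: "GRR G S" "card S = 3" and x: "x \<in> S" "\<not> involution G x"
  obtains y where "S = {x, inv x, y}" "inv x \<noteq> x" "inv y = y" "y \<in> carrier G"
proof -
  have conn: "S \<subseteq> carrier G" "\<one> \<notin> S" "S = (\<lambda>g. inv g) ` S"
    using S by (auto simp: GRR_def connection_set_def)
  then have inS: "inv s \<in> S" if "s \<in> S" for s using that by blast
  have xG: "x \<in> carrier G" "x \<noteq> \<one>" using x conn by auto
  have ne: "inv x \<noteq> x"
  proof
    assume "inv x = x"
    then have "x [^] (2::nat) = \<one>"
      using xG(1) r_inv[of x] by (simp add: numeral_2_eq_2)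
    then have "ord x dvd 2" using pow_eq_id xG(1) by blast
    moreover have "ord x \<noteq> 1" using xG ord_eq_1 by blast
    ultimately have "ord x = 2" using two_is_prime_nat prime_nat_iff by blast
    then show False using x(2) xG(1) by (simp add: involution_def)
  qed
  \<comment> \<open>Inversion permutes \<open>S\<close> and swaps \<open>x\<close> with its inverse, so it fixes the third element.\<close>
  have "card (S - {x, inv x}) = 1"
    using S(2) x(1) inS[OF x(1)] ne by (subst card_Diff_subset) auto
  then obtain y where y: "S - {x, inv x} = {y}" using card_1_singletonE by blast
  then have yS: "y \<in> S" "y \<noteq> x" "y \<noteq> inv x" by auto
  then have yG: "y \<in> carrier G" using conn by blast
  have "inv y \<noteq> x" "inv y \<noteq> inv x"
    using yS yG xG by auto
  then have "inv y = y" using inS[OF yS(1)] y by blast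
  moreover have "S = {x, inv x, y}" using y x(1) inS[OF x(1)] by blast
  ultimately show thesis using that ne yG by blast
qed

end

section \<open>Automorphisms and subgroups of central quotients\<close>

text \<open>The center is characteristic.  Every automorphism maps it into itself, and
  applying this to the inverse automorphism gives the reverse inclusion.\<close>

lemma iso_image_group_center:
  assumes "group G" and f: "f \<in> iso G G"
  shows "f ` group_center G = group_center G"
proof -
  have sub: "h ` group_center G \<subseteq> group_center G" if h: "h \<in> iso G G" for h
  proof
    fix w assume "w \<in> h ` group_center G"
    then obtain z where z: "w = h z" "z \<in> carrier G" "\<forall>g\<in>carrier G. z \<otimes>\<^bsub>G\<^esub> g = g \<otimes>\<^bsub>G\<^esub> z"
      by (auto simp: group_center_def)
    have hom: "h \<in> hom G G" and bij: "h ` carrier G = carrier G"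
      using h by (auto simp: iso_def bij_betw_def)
    have "h z \<otimes>\<^bsub>G\<^esub> g = g \<otimes>\<^bsub>G\<^esub> h z" if "g \<in> carrier G" for g
    proof -
      have "g \<in> h ` carrier G" using bij that by simp
      then obtain g' where g': "g = h g'" "g' \<in> carrier G" by (rule imageE)
      have "h (z \<otimes>\<^bsub>G\<^esub> g') = h (g' \<otimes>\<^bsub>G\<^esub> z)" using z(3) g'(2) by simp
      then show ?thesis using hom_mult[OF hom] z(2) g' by simp
    qed
    then show "w \<in> group_center G"
      using z hom_in_carrier[OF hom] by (auto simp: group_center_def)
  qed
  have fi: "inv_into (carrier G) f \<in> iso G G"
    using group.iso_set_sym[OF assms] .
  have "group_center G \<subseteq> f ` group_center G"
  proof
    fix z assume z: "z \<in> group_center G"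
    then have "z \<in> carrier G" by (simp add: group_center_def)
    then have "f (inv_into (carrier G) f z) = z"
      using f by (intro f_inv_into_f) (auto simp: iso_def bij_betw_def)
    then show "z \<in> f ` group_center G" using sub[OF fi] z by (metis image_eqI image_subset_iff)
  qed
  with sub[OF f] show ?thesis by blast
qed

lemma (in normal) hom_image_rcoset:
  assumes f: "f \<in> hom G G" and N: "f ` H = H" and a: "a \<in> carrier G"
  shows "f ` (H #> a) = H #> f a"
proof -
  have "f ` (H #> a) = (\<lambda>h. f h \<otimes> f a) ` H"
    using hom_mult[OF f] a subset by (force simp: r_coset_def image_iff)
  also have "\<dots> = (\<lambda>h. h \<otimes> f a) ` (f ` H)" by (simp add: image_image)
  also have "\<dots> = H #> f a" by (auto simp: N r_coset_def)
  finally show ?thesis .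
qed

text \<open>An automorphism preserving the normal subgroup descends to the quotient; since the elements of
  the quotient are cosets, the induced map is the image operation.\<close>

lemma (in normal) iso_FactGroup_image:
  assumes f: "f \<in> iso G G" and N: "f ` H = H"
  shows "image f \<in> iso (G Mod H) (G Mod H)"
proof -
  have hom: "f \<in> hom G G" and inj: "inj_on f (carrier G)" and surj: "f ` carrier G = carrier G"
    using f by (auto simp: iso_def bij_betw_def)
  note img = hom_image_rcoset[OF hom N]
  have fG: "f a \<in> carrier G" if "a \<in> carrier G" for a using hom_in_carrier[OF hom that] .
  have carr: "carrier (G Mod H) = (\<lambda>a. H #> a) ` carrier G"
    by (auto simp: FactGroup_def RCOSETS_def)
  have "image f ` carrier (G Mod H) = (\<lambda>a. H #> a) ` (f ` carrier G)"
    unfolding carr by (simp add: image_image img)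
  then have "image f ` carrier (G Mod H) = carrier (G Mod H)"
    by (simp add: surj carr)
  moreover have "inj_on (image f) (carrier (G Mod H))"
  proof (rule inj_on_subset[OF inj_on_image_Pow[OF inj]])
    show "carrier (G Mod H) \<subseteq> Pow (carrier G)"
      unfolding carr using r_coset_subset_G subset by blast
  qed
  moreover have "image f \<in> hom (G Mod H) (G Mod H)"
    using hom_mult[OF hom] fG
    unfolding hom_def carr by (auto simp: img rcos_sum)
  ultimately show ?thesis by (simp add: iso_def bij_betw_def)
qed

text \<open>Generation can be tested on representatives: a subgroup containing \<open>H\<close> is the full
  preimage of its image in the quotient.\<close>

lemma (in normal) GRR_FactGroup_generates:
  assumes S: "GRR (G Mod H) S" "S \<noteq> {}" "S \<subseteq> (\<lambda>a. H #> a) ` K"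
    and K: "subgroup K G" "H \<subseteq> K"
  shows "K = carrier G"
proof -
  interpret Q: group "G Mod H" by (rule factorgroup_is_group)
  interpret p: group_hom G "G Mod H" "\<lambda>a. H #> a"
    using r_coset_hom_Mod by unfold_locales
  have "subgroup ((\<lambda>a. H #> a) ` K) (G Mod H)"
    by (rule p.subgroup_img_is_subgroup[OF K(1)])
  from Q.GRR_generates[OF S(1,2) this S(3)]
  have all: "(\<lambda>a. H #> a) ` K = carrier (G Mod H)" .
  have "a \<in> K" if a: "a \<in> carrier G" for a
  proof -
    have "H #> a \<in> (\<lambda>a. H #> a) ` K" using a all by simp
    then obtain b where b: "b \<in> K" "H #> a = H #> b" by (rule imageE)
    then have "a \<in> H #> b" using rcos_self[OF a subgroup_axioms] by simp
    then obtain h where "h \<in> H" "a = h \<otimes> b" by (auto simp: r_coset_def)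
    then show ?thesis using b(1) K subgroup.m_closed[OF K(1), of h b] by blast
  qed
  then show ?thesis using subgroup.subset[OF K(1)] by blast
qed

section \<open>The commutator of two matrices of size two\<close>

text \<open>By the Cayley--Hamilton theorem, \<open>A\<^sup>2 = (tr A) A - (det A) 1\<close>, which gives
  \<open>(AB - BA) A = adj(A) (AB - BA)\<close> for the adjugate \<open>adj(A) = (tr A) 1 - A\<close>; multiplying by
  \<open>A\<close> on the left turns \<open>adj(A)\<close> into \<open>det A\<close>.  The resulting identity
  \<open>A (AB - BA) A = (det A) (AB - BA)\<close> is polynomial in the eight entries and is verified
  entrywise.\<close>

lemma commutator_sandwich:
  fixes A B :: "'a::field^2^2"
  shows "A \<in> carrier SL \<Longrightarrow> A ** (A ** B - B ** A) ** A = A ** B - B ** A" (is "_ \<Longrightarrow> ?thA")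
    and "B \<in> carrier SL \<Longrightarrow> B ** (A ** B - B ** A) ** B = A ** B - B ** A" (is "_ \<Longrightarrow> ?thB")
proof -
  let ?C = "A ** B - B ** A"
  have "A ** ?C ** A = (\<chi> i j. det A * ?C $ i $ j)" "B ** ?C ** B = (\<chi> i j. det B * ?C $ i $ j)"
    by (simp_all add: vec_eq_iff matrix_matrix_mult_def forall_2 sum_2 det_2 algebra_simps)
  then show "A \<in> carrier SL \<Longrightarrow> ?thA" "B \<in> carrier SL \<Longrightarrow> ?thB"
    by (simp_all add: SL_def vec_eq_iff)
qed

lemma SL_conj_iso:
  fixes C D :: "'a::field^'n^'n"
  assumes "C ** D = mat 1" "D ** C = mat 1"
  shows "(\<lambda>M. C ** M ** D) \<in> iso SL SL"
proof -
  have dets: "det C * det D = 1" "det D * det C = 1"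
    using assms by (metis det_I det_mul)+
  have dd: "det (C ** M ** D) = det M" "det (D ** M ** C) = det M" for M
    using dets by (simp_all add: det_mul mult.commute mult.left_commute)
  have inv: "D ** (C ** M ** D) ** C = M" "C ** (D ** M ** C) ** D = M" for M
    using assms by (metis matrix_mul_assoc matrix_mul_lid matrix_mul_rid)+
  have "C ** (M ** N) ** D = (C ** M ** D) ** (C ** N ** D)" for M N
    using assms by (metis matrix_mul_assoc matrix_mul_lid)
  moreover have "bij_betw (\<lambda>M. C ** M ** D) (carrier SL) (carrier SL)"
    by (rule bij_betw_byWitness[where f' = "\<lambda>M. D ** M ** C"]) (auto simp: SL_def dd inv)
  ultimately show ?thesis by (auto simp: iso_def hom_def SL_def dd)
qed

text \<open>The two elementary transvections witness that the subgroups below are proper: a matrix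
  commuting with both is scalar, and a matrix whose nonzero kernel is preserved by both is zero.\<close>

definition transv12 :: "'a::field^2^2" where
  "transv12 = vector [vector [1, 1], vector [0, 1]]"

definition transv21 :: "'a::field^2^2" where
  "transv21 = vector [vector [1, 0], vector [1, 1]]"

lemma transv_in_SL: "transv12 \<in> carrier SL" "transv21 \<in> carrier SL"
  by (simp_all add: SL_def transv12_def transv21_def det_2)

lemma commutes_transv_imp_center:
  fixes A :: "'a::field^2^2"
  assumes "A \<in> carrier SL" "A ** transv12 = transv12 ** A" "A ** transv21 = transv21 ** A"
  shows "A \<in> group_center SL"
proof -
  have "A$1$2 = 0" "A$2$1 = 0" "A$1$1 = A$2$2"
    using assms(2,3)
    by (auto simp: vec_eq_iff matrix_matrix_mult_def forall_2 sum_2 transv12_def transv21_def)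
  then have "A ** M = M ** A" for M
    by (simp add: vec_eq_iff matrix_matrix_mult_def forall_2 sum_2 mult.commute)
  then show ?thesis using assms(1) by (simp add: group_center_def SL_def)
qed

text \<open>If \<open>v = (a, b)\<close>, then the transvections move \<open>v\<close> by \<open>(b, 0)\<close> and \<open>(0, a)\<close>.  A
  kernel containing \<open>v \<noteq> 0\<close> and both images therefore contains a coordinate vector, and
  with it the other one.\<close>

lemma kernel_transv_invariant_imp_zero:
  fixes C :: "'a::field^2^2"
  assumes "v \<noteq> 0" "C *v v = 0" "C *v (transv12 *v v) = 0" "C *v (transv21 *v v) = 0"
  shows "C = 0"
proof -
  have v: "v$1 \<noteq> 0 \<or> v$2 \<noteq> 0" using assms(1) by (auto simp: vec_eq_iff forall_2)
  have "(C *v (transv12 *v v) - C *v v) $ i = C$i$1 * v$2"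
       "(C *v (transv21 *v v) - C *v v) $ i = C$i$2 * v$1"
       "(C *v v) $ i = C$i$1 * v$1 + C$i$2 * v$2" for i
    by (simp_all add: matrix_vector_mult_def sum_2 transv12_def transv21_def algebra_simps)
  then have "C$i$1 * v$2 = 0" "C$i$2 * v$1 = 0" "C$i$1 * v$1 + C$i$2 * v$2 = 0" for i
    using assms(2-) by (metis diff_self zero_index)+
  then have "C$i$1 = 0 \<and> C$i$2 = 0" for i
    using v by (metis add_0 add.right_neutral mult_eq_0_iff)
  then show ?thesis by (simp add: vec_eq_iff forall_2)
qed

lemma SL_inv: "A \<in> carrier SL \<Longrightarrow> A ** inv\<^bsub>SL\<^esub> A = mat 1"
  "A \<in> carrier SL \<Longrightarrow> inv\<^bsub>SL\<^esub> A ** A = mat 1"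
  using group.r_inv[OF group_SL, of A] group.l_inv[OF group_SL, of A] by (simp_all add: SL_def)

lemma subgroup_SL_centralizer:
  "subgroup {M \<in> carrier SL. M ** A = A ** M} SL"
proof (rule group.subgroupI[OF group_SL])
  show "{M \<in> carrier SL. M ** A = A ** M} \<noteq> {}"
    by (auto simp: SL_def intro!: exI[of _ "mat 1"])
next
  fix M assume "M \<in> {M \<in> carrier SL. M ** A = A ** M}"
  then have M: "M \<in> carrier SL" "M ** A = A ** M" by auto
  have "inv\<^bsub>SL\<^esub> M ** A = inv\<^bsub>SL\<^esub> M ** (A ** M) ** inv\<^bsub>SL\<^esub> M"
    by (simp add: SL_inv[OF M(1)] flip: matrix_mul_assoc)
  also have "\<dots> = A ** inv\<^bsub>SL\<^esub> M"
    by (simp add: SL_inv[OF M(1)] matrix_mul_assoc flip: M(2))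
  finally show "inv\<^bsub>SL\<^esub> M \<in> {M \<in> carrier SL. M ** A = A ** M}"
    using group.inv_closed[OF group_SL M(1)] by simp
next
  fix M N assume "M \<in> {M \<in> carrier SL. M ** A = A ** M}" "N \<in> {M \<in> carrier SL. M ** A = A ** M}"
  then show "M \<otimes>\<^bsub>SL\<^esub> N \<in> {M \<in> carrier SL. M ** A = A ** M}"
    by (auto simp: SL_def det_mul) (metis matrix_mul_assoc)
qed auto

text \<open>Requiring an equivalence rather than the inclusion of the kernel in its preimage makes closure
  under inverses immediate, without a dimension argument.\<close>

lemma subgroup_SL_kernel_stabilizer:
  "subgroup {M \<in> carrier SL. \<forall>v. C *v (M *v v) = 0 \<longleftrightarrow> C *v v = 0} SL" (is "subgroup ?K SL")
proof (rule group.subgroupI[OF group_SL])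
  show "?K \<noteq> {}"
    by (auto simp: SL_def intro!: exI[of _ "mat 1"])
next
  fix M assume "M \<in> ?K"
  then have M: "M \<in> carrier SL" "\<And>v. C *v (M *v v) = 0 \<longleftrightarrow> C *v v = 0" by auto
  have "M *v (inv\<^bsub>SL\<^esub> M *v v) = v" for v
    by (simp add: matrix_vector_mul_assoc SL_inv[OF M(1)])
  then have "C *v (inv\<^bsub>SL\<^esub> M *v v) = 0 \<longleftrightarrow> C *v v = 0" for v
    using M(2)[of "inv\<^bsub>SL\<^esub> M *v v"] by simp
  then show "inv\<^bsub>SL\<^esub> M \<in> ?K"
    using group.inv_closed[OF group_SL M(1)] by simp
next
  fix M N assume "M \<in> ?K" "N \<in> ?K"
  then show "M \<otimes>\<^bsub>SL\<^esub> N \<in> ?K"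
    by (auto simp: SL_def det_mul simp flip: matrix_vector_mul_assoc)
qed auto

text \<open>The equation \<open>MCM = C\<close> with \<open>C\<close> invertible says \<open>CMC\<^sup>-\<^sup>1 = M\<^sup>-\<^sup>1\<close>; the commutator
  satisfies it for \<open>M = A\<close> and \<open>M = B\<close> at once.\<close>

lemma SL2_simultaneous_inversion:
  fixes A B :: "'a::field^2^2"
  assumes A: "A \<in> carrier SL" and B: "B \<in> carrier SL" and inv: "invertible (A ** B - B ** A)"
  obtains f where "f \<in> iso SL SL" "f A = inv\<^bsub>SL\<^esub> A" "f B = inv\<^bsub>SL\<^esub> B"
proof -
  define C where "C = A ** B - B ** A"
  obtain D where D: "C ** D = mat 1" "D ** C = mat 1"
    using inv by (auto simp: C_def invertible_def)
  define f where "f = (\<lambda>M. C ** M ** D)"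
  have f: "f \<in> iso SL SL" unfolding f_def by (rule SL_conj_iso[OF D])
  have inverts: "f M = inv\<^bsub>SL\<^esub> M" if M: "M \<in> carrier SL" "M ** C ** M = C" for M
  proof (rule group.inv_equality[OF group_SL, symmetric])
    have "M ** f M = mat 1"
      using M(2) D(1) by (simp add: f_def matrix_mul_assoc)
    then show "f M \<otimes>\<^bsub>SL\<^esub> M = \<one>\<^bsub>SL\<^esub>"
      by (simp add: SL_def matrix_left_right_inverse)
    show "f M \<in> carrier SL" using f M(1) by (auto simp: iso_def hom_def)
  qed (rule M(1))
  show thesis
    using that[OF f] inverts[OF A] inverts[OF B] commutator_sandwich(1)[OF A, of B]
      commutator_sandwich(2)[OF B, of A] by (simp add: C_def)
qed

text \<open>For a nonzero singular \<open>C\<close>, the equation \<open>MCM = C\<close> says that \<open>M\<close> preserves the kernel of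
  \<open>C\<close>, so that \<open>A\<close> and \<open>B\<close> have a common eigenvector.  The kernel is then proper and nonzero,
  and the transvections do not both preserve it.  For \<open>C = 0\<close> the kernel is the
  whole space, and the centralizer of \<open>A\<close> takes the place of the stabilizer.\<close>

lemma SL2_singular_commutator_subgroup:
  fixes A B :: "'a::field^2^2"
  assumes A: "A \<in> carrier SL" "A \<notin> group_center SL" and B: "B \<in> carrier SL"
    and sing: "\<not> invertible (A ** B - B ** A)"
  obtains K where "subgroup K SL" "group_center SL \<subseteq> K" "A \<in> K" "B \<in> K" "K \<noteq> carrier SL"
proof (cases "A ** B = B ** A")
  case True
  define K where "K = {M \<in> carrier SL. M ** A = A ** M}"
  have "K \<noteq> carrier SL"
  proof
    assume "K = carrier SL"
    then have "transv12 \<in> K" "transv21 \<in> K" using transv_in_SL by auto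
    then show False
      using commutes_transv_imp_center[OF A(1)] A(2) by (simp add: K_def)
  qed
  moreover have "group_center SL \<subseteq> K"
    using A(1) by (auto simp: K_def group_center_def SL_def)
  moreover have "subgroup K SL" unfolding K_def by (rule subgroup_SL_centralizer)
  ultimately show thesis using that[of K] A B True by (simp add: K_def)
next
  case False
  define C where "C = A ** B - B ** A"
  define K where "K = {M \<in> carrier SL. \<forall>v. C *v (M *v v) = 0 \<longleftrightarrow> C *v v = 0}"
  have C0: "C \<noteq> 0" using False by (simp add: C_def)
  have inj: "M *v w = 0 \<longleftrightarrow> w = 0" if "M \<in> carrier SL" for M :: "'a^2^2" and w
    using SL_inv(2)[OF that] by (metis matrix_vector_mul_assoc matrix_vector_mul_lid matrix_vector_mult_0_right)
  have memK: "M \<in> K" if M: "M \<in> carrier SL" "M ** C ** M = C" for M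
  proof -
    have "M *v (C *v (M *v v)) = C *v v" for v
      using M(2) by (simp add: matrix_vector_mul_assoc matrix_mul_assoc)
    then have "C *v (M *v v) = 0 \<longleftrightarrow> C *v v = 0" for v
      using inj[OF M(1), of "C *v (M *v v)"] by simp
    then show ?thesis using M(1) by (simp add: K_def)
  qed
  have AK: "A \<in> K" and BK: "B \<in> K"
    using memK[OF A(1)] memK[OF B] commutator_sandwich(1)[OF A(1), of B]
      commutator_sandwich(2)[OF B, of A] by (simp_all add: C_def)
  have "group_center SL \<subseteq> K"
  proof
    \<comment> \<open>A central matrix commutes with \<open>A\<close> and \<open>B\<close>, hence with \<open>C\<close>.\<close>
    fix z :: "'a^2^2" assume "z \<in> group_center SL"
    then have z: "z \<in> carrier SL" and "z ** A = A ** z" "z ** B = B ** z"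
      using A(1) B by (auto simp: group_center_def SL_def)
    then have "A ** B ** z = z ** (A ** B)" "B ** A ** z = z ** (B ** A)"
      by (metis matrix_mul_assoc)+
    moreover have "(M - N) ** z = M ** z - N ** z" "z ** (M - N) = z ** M - z ** N"
      for M N :: "'a^2^2"
      by (simp_all add: vec_eq_iff matrix_matrix_mult_def sum_2 algebra_simps)
    ultimately have "C ** z = z ** C" by (simp add: C_def)
    then have "C *v (z *v v) = z *v (C *v v)" for v
      by (simp add: matrix_vector_mul_assoc)
    then show "z \<in> K" using z inj[OF z] by (simp add: K_def)
  qed
  moreover have "K \<noteq> carrier SL"
  proof
    assume K: "K = carrier SL"
    obtain v where "v \<noteq> 0" "C *v v = 0"
      using sing C_def invertible_left_inverse matrix_left_invertible_ker by metis
    moreover have "transv12 \<in> K" "transv21 \<in> K" using transv_in_SL K by auto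
    ultimately show False
      using kernel_transv_invariant_imp_zero[of v C] C0 by (simp add: K_def)
  qed
  moreover have "subgroup K SL" unfolding K_def by (rule subgroup_SL_kernel_stabilizer)
  ultimately show thesis using that[of K] AK BK by blast
qed

theorem proposition1p5:
  fixes q :: nat
    and G :: "('a::{field,finite}^2^2) set monoid"
    and S :: "('a^2^2) set set"
  assumes "primepow q" and "q \<ge> 5" and "CARD('a) = q"
    and "G = PSL"
    and "cubic_GRR G S"
  shows "card S = 3 \<and> (\<forall>x \<in> S. involution G x)"
proof (intro conjI ballI)
  let ?SL = "SL :: ('a^2^2) monoid"
  let ?Z = "group_center ?SL"
  let ?p = "r_coset ?SL ?Z"
  have S: "GRR G S" and card: "card S = 3"
    using assms(5) by (simp_all add: cubic_GRR_def)
  show "card S = 3" by (rule card)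
  have G: "G = ?SL Mod ?Z" using assms(4) by (simp add: PSL_def)
  have carr: "carrier G = ?p ` carrier ?SL"
    by (auto simp: G FactGroup_def RCOSETS_def)
  interpret Z: normal ?Z ?SL
    by (rule group.normal_group_center[OF group_SL])
  interpret Q: group G unfolding G by (rule Z.factorgroup_is_group)
  interpret p: group_hom ?SL G ?p
    using Z.r_coset_hom_Mod by unfold_locales (simp add: G)
  fix x assume x: "x \<in> S"
  show "involution G x"
  proof (rule ccontr)
    assume "\<not> involution G x"
    from Q.GRR_card_3_non_involution[OF S card x this] obtain y where
      Sxy: "S = {x, inv\<^bsub>G\<^esub> x, y}" and ne: "inv\<^bsub>G\<^esub> x \<noteq> x"
      and y: "inv\<^bsub>G\<^esub> y = y" "y \<in> carrier G" .
    have xG: "x \<in> carrier G" "x \<noteq> \<one>\<^bsub>G\<^esub>"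
      using S x by (auto simp: GRR_def connection_set_def)
    obtain A where A: "x = ?p A" "A \<in> carrier ?SL"
      using xG(1) unfolding carr by (rule imageE)
    obtain B where B: "y = ?p B" "B \<in> carrier ?SL"
      using y(2) unfolding carr by (rule imageE)
    show False
    proof (cases "invertible (A ** B - B ** A)")
      case True
      obtain f where f: "f \<in> iso ?SL ?SL" and fA: "f A = inv\<^bsub>?SL\<^esub> A" and fB: "f B = inv\<^bsub>?SL\<^esub> B"
        using SL2_simultaneous_inversion[OF A(2) B(2) True] .
      have hom: "f \<in> hom ?SL ?SL" using f by (simp add: iso_def)
      note fZ = iso_image_group_center[OF group_SL f]
      have iso: "image f \<in> iso G G" unfolding G by (rule Z.iso_FactGroup_image[OF f fZ])
      then interpret F: group_hom G G "image f" by unfold_locales (simp add: iso_def)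
      have Fx: "f ` x = inv\<^bsub>G\<^esub> x" and Fy: "f ` y = y"
        using Z.hom_image_rcoset[OF hom fZ] A B fA fB y(1) by simp_all
      then have "image f ` S = S"
        using xG(1) F.hom_inv[OF xG(1)] by (auto simp: Sxy)
      from Q.GRR_automorphism_trivial[OF S iso this xG(1)] Fx ne show False by simp
    next
      case False
      have "A \<notin> ?Z"
      proof
        assume "A \<in> ?Z"
        then have "x = ?Z" unfolding A(1) by (rule Z.rcos_const[OF Z.is_group])
        then show False using xG(2) by (simp add: G FactGroup_def)
      qed
      then obtain K where K: "subgroup K ?SL" "?Z \<subseteq> K" "A \<in> K" "B \<in> K" "K \<noteq> carrier ?SL"
        using SL2_singular_commutator_subgroup[OF A(2) _ B(2) False] by blast
      have "inv\<^bsub>G\<^esub> x = ?p (inv\<^bsub>?SL\<^esub> A)" using A by simp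
      then have "inv\<^bsub>G\<^esub> x \<in> ?p ` K"
        using subgroup.m_inv_closed[OF K(1,3)] by (rule image_eqI)
      moreover have "x \<in> ?p ` K" unfolding A(1) by (rule imageI[OF K(3)])
      moreover have "y \<in> ?p ` K" unfolding B(1) by (rule imageI[OF K(4)])
      ultimately have "S \<subseteq> ?p ` K" by (simp add: Sxy)
      then show False
        using Z.GRR_FactGroup_generates[OF _ _ _ K(1,2), of S] S x K(5) by (auto simp: G)
    qed
  qed
qed

end
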